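(* Let $(X,d)$ be a metric space, $\mu$ a Borel probability measure on $X$ and $T\colon X\to X$ a $\mu$-preserving transformation. Suppose $\mu$ satisfies condition (A) with exponent $\delta\in(0,2)$. Let $(B_i)_{i\ge0}$ be balls in $X$ such that, for some $0<\beta<1$ and some $\gamma>1+\frac{(2-\delta)(1-\beta)}{2+\delta}$, \[ \mu(B_i)\ge i^{-\beta}(\log i)^{\gamma}\quad\text{for all sufficiently large } i. \] If $(T,X,\mu,d)$ has polynomial decay of correlations with rate $\alpha=\frac{2/\delta+\beta}{1-\beta}$, then \[ \frac{\sum_{i=0}^{n-1}1_{B_i}(T^ix)}{\sum_{i=0}^{n-1}\mu(B_i)}\to1\quad\text{as } n\to\infty,\ \text{for } \mu\text{-a.e. } x\in X. \]
   Context: Condition (A) with exponent $\delta$ ($0<\delta<2$): there exist $C>0$ and $r_0>0$ such that for all $x_0\in X$, $0<r\le r_0$ and $0<\epsilon\le1$, $\mu(\{x: r<d(x,x_0)<r+\epsilon\})<C\epsilon^{\delta}$. Convention: if the $B_i=B(x_0,r_i)$ are nested balls with $r_i\to0$, all centered at one given point $x_0$, then this inequality is only required for that point $x_0$. Polynomial decay of correlations with rate $\alpha>0$: there is a constant $C>0$ such that for all Lipschitz functions $\varphi,\psi\colon X\to\mathbb{R}$ and all $n\ge1$, $\left|\int\varphi\circ T^n\,\psi\,d\mu-\int\varphi\,d\mu\int\psi\,d\mu\right|\le c(n)\|\varphi\|_{\mathrm{Lip}}\|\psi\|_{\mathrm{Lip}}$ with $c(n)\le Cn^{-\alpha}$,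 where $\|\cdot\|_{\mathrm{Lip}}$ is the usual Lipschitz norm (supremum norm plus least Lipschitz constant).
   Formalization: The radii of the balls B_i are assumed to be eventually at most the threshold r_0 of condition (A) (automatic when r_i → 0); without this the claim fails, since (A) gives no control over balls of larger radius. *)

theory Defs
  imports "HOL-Probability.Probability"
begin

definition measure_preserving_map :: "'a measure \<Rightarrow> ('a \<Rightarrow> 'a) \<Rightarrow> bool" where
  "measure_preserving_map M T \<longleftrightarrow> T \<in> measurable M M \<and> distr M M T = M"

text \<open>
  Condition (A) with exponent \<open>\<delta>\<close>, required at the points of \<open>S\<close>. The threshold \<open>r0\<close> is a
  parameter, so that the radii of a given sequence of balls can be compared with it. The constant
  \<open>C\<close> is uniform over \<open>S\<close>.
\<close>

definition condition_A :: "'a::metric_space measure \<Rightarrow> real \<Rightarrow> real \<Rightarrow> 'a set \<Rightarrow> bool" where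
  "condition_A M \<delta> r0 S \<longleftrightarrow> r0 > 0 \<and>
     (\<exists>C>0. \<forall>x0\<in>S. \<forall>r \<epsilon>. 0 < r \<and> r \<le> r0 \<and> 0 < \<epsilon> \<and> \<epsilon> \<le> 1 \<longrightarrow>
        measure M {x. r < dist x x0 \<and> dist x x0 < r + \<epsilon>} < C * \<epsilon> powr \<delta>)"

text \<open>
  The points at which condition (A) is required for the balls \<open>ball (p i) (r i)\<close>: only the common
  centre if the balls are nested and concentric with radii tending to 0, and all points otherwise.
\<close>

definition condition_A_points :: "(nat \<Rightarrow> 'a::metric_space) \<Rightarrow> (nat \<Rightarrow> real) \<Rightarrow> 'a set" where
  "condition_A_points p r =
     (if (\<forall>i. p i = p 0) \<and> decseq (\<lambda>i. ball (p i) (r i)) \<and> r \<longlonglongrightarrow> 0 then {p 0} else UNIV)"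

definition bounded_lipschitz :: "('a::metric_space \<Rightarrow> real) \<Rightarrow> bool" where
  "bounded_lipschitz f \<longleftrightarrow> bounded (range f) \<and> (\<exists>L. L-lipschitz_on UNIV f)"

text \<open>
  Supremum norm plus least Lipschitz constant; meaningful only for bounded Lipschitz functions.
\<close>

definition lip_norm :: "('a::metric_space \<Rightarrow> real) \<Rightarrow> real" where
  "lip_norm f = (SUP x. \<bar>f x\<bar>) + Inf {L. L-lipschitz_on UNIV f}"

definition polynomial_decay :: "'a::metric_space measure \<Rightarrow> ('a \<Rightarrow> 'a) \<Rightarrow> real \<Rightarrow> bool" where
  "polynomial_decay M T \<alpha> \<longleftrightarrow>
     (\<exists>C>0. \<forall>\<phi> \<psi>. bounded_lipschitz \<phi> \<and> bounded_lipschitz \<psi> \<longrightarrow>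
        (\<forall>n\<ge>1. \<bar>(\<integral>x. \<phi> ((T ^^ n) x) * \<psi> x \<partial>M) - (\<integral>x. \<phi> x \<partial>M) * (\<integral>x. \<psi> x \<partial>M)\<bar>
           \<le> C * real n powr (- \<alpha>) * lip_norm \<phi> * lip_norm \<psi>))"

end

theory Submission
  imports Defs "HOL-Real_Asymp.Real_Asymp"
begin

text \<open>
  Let \<open>E n\<close> be the sum of the first \<open>n\<close> measures. The covariance of two hits is at most the
  measure of the later ball. For a long gap it is estimated instead by replacing the indicators by
  Lipschitz bumps supported in slightly larger balls: condition (A) bounds the measure of the
  added collars and decay of correlations bounds the covariance of the bumps. Using the trivial
  bound for gaps up to \<open>E n * n powr (- \<sigma>)\<close> and a collar thickness depending only on \<open>n\<close>, the
  variance of the number of hits up to time \<open>n\<close> is \<open>O(E n powr (2 - \<sigma>))\<close> for some \<open>\<sigma> > 0\<close>.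
  Dividing by \<open>(E n)\<^sup>2\<close>, these bounds are summable along a subsequence on which \<open>E\<close> grows like a
  large power of the index, which yields almost sure convergence there; since consecutive values of \<open>E\<close> then have ratio tending to 1,
  monotonicity gives convergence along the whole sequence.
\<close>

section \<open>Almost sure convergence from variance bounds\<close>

text \<open>For \<open>N k \<le> n \<le> N (Suc k)\<close> monotonicity traps
  \<open>S n / E n\<close> between \<open>S (N k) / E (N (Suc k))\<close> and
  \<open>S (N (Suc k)) / E (N k)\<close>, which differ from ratios along \<open>N\<close> only by
  factors tending to 1.\<close>

lemma tendsto_ratio_interpolate:
  fixes S E :: "nat \<Rightarrow> real" and N :: "nat \<Rightarrow> nat"
  assumes S: "mono S" "\<And>n. 0 \<le> S n" and E: "mono E" and pos: "\<And>k. 0 < E (N k)"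
    and N: "filterlim N at_top sequentially"
    and SE: "(\<lambda>k. S (N k) / E (N k)) \<longlonglongrightarrow> 1"
    and EE: "(\<lambda>k. E (N (Suc k)) / E (N k)) \<longlonglongrightarrow> 1"
  shows "(\<lambda>n. S n / E n) \<longlonglongrightarrow> 1"
proof (rule tendstoI)
  fix e :: real assume e: "0 < e"
  have pos': "E (N k) \<noteq> 0" for k using pos[of k] by simp
  have "(\<lambda>k. (S (N k) / E (N k)) / (E (N (Suc k)) / E (N k))) \<longlonglongrightarrow> 1 / 1"
    by (intro tendsto_divide SE EE) simp
  then have lo: "(\<lambda>k. S (N k) / E (N (Suc k))) \<longlonglongrightarrow> 1" using pos' by simp
  have "(\<lambda>k. (S (N (Suc k)) / E (N (Suc k))) * (E (N (Suc k)) / E (N k))) \<longlonglongrightarrow> 1 * 1"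
    by (intro tendsto_mult LIMSEQ_Suc[OF SE] EE)
  then have hi: "(\<lambda>k. S (N (Suc k)) / E (N k)) \<longlonglongrightarrow> 1" using pos' by simp
  have "eventually (\<lambda>k. 1 - e < S (N k) / E (N (Suc k)) \<and> S (N (Suc k)) / E (N k) < 1 + e)
      sequentially"
    using order_tendstoD(1)[OF lo, of "1 - e"] order_tendstoD(2)[OF hi, of "1 + e"] e
    by (auto intro: eventually_conj)
  then obtain k0 where k0: "\<And>k. k \<ge> k0 \<Longrightarrow>
      1 - e < S (N k) / E (N (Suc k)) \<and> S (N (Suc k)) / E (N k) < 1 + e"
    unfolding eventually_sequentially by auto
  have "dist (S n / E n) 1 < e" if n: "n \<ge> N k0" for n
  proof -
    \<comment> \<open>As \<open>N\<close> may fail to be monotone, the interval containing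
      \<open>n\<close> is found from the least \<open>l \<ge> k0\<close> with
      \<open>n < N l\<close>: the bound \<open>n \<ge> N k0\<close> forces \<open>l > k0\<close>,
      and minimality gives \<open>N (l - 1) \<le> n\<close>.\<close>
    define P where "P k \<longleftrightarrow> k \<ge> k0 \<and> n < N k" for k
    have "eventually (\<lambda>k. n < N k \<and> k \<ge> k0) sequentially"
      using N by (intro eventually_conj eventually_ge_at_top) (auto simp: filterlim_iff)
    then obtain k' where "P k'" unfolding P_def eventually_sequentially by blast
    then have "P (Least P)" by (rule LeastI)
    then obtain l where l: "Least P = l" "P l" by blast
    then have "k0 < l" using n unfolding P_def by (cases "l = k0") auto
    then obtain k where k: "l = Suc k" "k \<ge> k0" by (cases l) auto
    have "\<not> P k" using k(1) l(1) by (intro not_less_Least) simp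
    then have le1: "N k \<le> n" using k(2) unfolding P_def by auto
    have le2: "n \<le> N (Suc k)" using l k unfolding P_def by simp
    have En: "E (N k) \<le> E n" "E n \<le> E (N (Suc k))" "S (N k) \<le> S n" "S n \<le> S (N (Suc k))"
      using le1 le2 S(1) E by (auto dest: monoD)
    have "S (N k) / E (N (Suc k)) \<le> S n / E n"
      using En pos[of k] S(2) by (intro frac_le) auto
    moreover have "S n / E n \<le> S (N (Suc k)) / E (N k)"
      using En pos[of k] S(2) by (intro frac_le) auto
    ultimately show ?thesis using k0[OF k(2)] by (auto simp: dist_real_def)
  qed
  then show "eventually (\<lambda>n. dist (S n / E n) 1 < e) sequentially"
    unfolding eventually_sequentially by blast
qed

text \<open>The expectation of the whole series is the sum of the expectations, hence finite; so the
  series converges almost surely and its terms tend to 0.\<close>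

lemma (in prob_space) AE_tendsto_0_if_summable_expectation:
  fixes Y :: "nat \<Rightarrow> 'a \<Rightarrow> real"
  assumes "\<And>k. integrable M (Y k)" and "\<And>k x. 0 \<le> Y k x"
    and "summable (\<lambda>k. expectation (Y k))"
  shows "AE x in M. (\<lambda>k. Y k x) \<longlonglongrightarrow> 0"
proof -
  have m[measurable]: "Y k \<in> borel_measurable M" for k using assms(1) by auto
  have "(\<integral>\<^sup>+x. (\<Sum>k. ennreal (Y k x)) \<partial>M) = (\<Sum>k. \<integral>\<^sup>+x. ennreal (Y k x) \<partial>M)"
    by (intro nn_integral_suminf) measurable
  also have "\<dots> = (\<Sum>k. ennreal (expectation (Y k)))"
    using assms by (intro suminf_cong nn_integral_eq_integral) auto
  also have "\<dots> \<noteq> \<infinity>"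
    using assms by (simp add: ennreal_suminf_neq_top integral_nonneg)
  finally have "AE x in M. (\<Sum>k. ennreal (Y k x)) \<noteq> \<infinity>"
    by (intro nn_integral_PInf_AE) auto
  then show ?thesis
  proof eventually_elim
    case (elim x)
    have "summable (\<lambda>k. Y k x)"
      using elim assms(2) by (intro summable_suminf_not_top) auto
    then show ?case by (rule summable_LIMSEQ_zero)
  qed
qed

text \<open>The squared relative error has expectation at most
  \<open>C * E n powr (- \<sigma>)\<close> for large \<open>n\<close>. Sampling when
  \<open>E\<close> first reaches the levels \<open>real (Suc k) ^ q\<close> makes these bounds
  summable, while polynomial levels are dense enough for interpolation.\<close>

lemma (in prob_space) strong_law_if_variance_bound:
  fixes X :: "nat \<Rightarrow> 'a \<Rightarrow> real" and C \<sigma> :: real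
  defines "E \<equiv> \<lambda>n. \<Sum>i<n. expectation (X i)"
  assumes meas[measurable]: "\<And>i. X i \<in> borel_measurable M"
    and X: "\<And>i x. 0 \<le> X i x" "\<And>i x. X i x \<le> 1"
    and E: "filterlim E at_top sequentially" and "0 < \<sigma>"
    and var: "eventually (\<lambda>n. expectation (\<lambda>x. ((\<Sum>i<n. X i x) - E n)\<^sup>2) \<le> C * E n powr (2 - \<sigma>))
      sequentially"
  shows "AE x in M. (\<lambda>n. (\<Sum>i<n. X i x) / E n) \<longlonglongrightarrow> 1"
proof -
  have bX: "\<bar>X i x\<bar> \<le> 1" for i x using X(1)[of i x] X(2)[of i x] by auto
  have intX: "integrable M (X i)" for i
    by (rule integrable_const_bound[where B=1]) (auto simp: bX)
  have mX: "0 \<le> expectation (X i)" "expectation (X i) \<le> 1" for i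
    using X intX by (auto intro!: integral_nonneg integral_le_const)
  \<comment> \<open>Chosen so that \<open>q * \<sigma> \<ge> 2\<close>: the expectations along the
    subsequence are then dominated by a multiple of inverse squares.\<close>
  obtain q :: nat where q: "2 / \<sigma> < real q" using reals_Archimedean2 by blast
  then have q0: "0 < q" using \<open>0 < \<sigma>\<close> by (cases q) (auto simp: field_simps)
  have qs: "2 \<le> real q * \<sigma>" using q \<open>0 < \<sigma>\<close> by (simp add: field_simps)
  \<comment> \<open>The base \<open>Suc k\<close> keeps every level at least 1, so that division by
    \<open>E (N k)\<close> is harmless.\<close>
  define N where "N k = (LEAST n. real (Suc k) ^ q \<le> E n)" for k
  have EN: "real (Suc k) ^ q \<le> E (N k)" for k
  proof -
    have "eventually (\<lambda>n. real (Suc k) ^ q \<le> E n) sequentially"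
      using E unfolding filterlim_at_top by blast
    then obtain n where "real (Suc k) ^ q \<le> E n" unfolding eventually_sequentially by auto
    then show ?thesis unfolding N_def by (rule LeastI)
  qed
  have EN1: "1 \<le> E (N k)" for k
    using EN[of k] one_le_power[of "real (Suc k)" q] by linarith
  \<comment> \<open>One further term adds at most 1 to \<open>E\<close>, so the level is overshot by
    at most 1 when it is first reached. The first time is not 0 because the empty sum is below
    1.\<close>
  have EN': "E (N k) \<le> real (Suc k) ^ q + 1" for k
  proof -
    have "N k \<noteq> 0" using EN1[of k] by (auto simp: E_def intro: gr0I)
    then obtain n where n: "N k = Suc n" by (cases "N k") auto
    then have "\<not> real (Suc k) ^ q \<le> E n"
      using not_less_Least[of n "\<lambda>n. real (Suc k) ^ q \<le> E n"] unfolding N_def by auto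
    moreover have "E (N k) \<le> E n + 1" using mX[of n] unfolding n E_def by simp
    ultimately show ?thesis by linarith
  qed
  have Ele: "E n \<le> real n" for n
    using sum_bounded_above[of "{..<n}" "\<lambda>i. expectation (X i)" 1] mX unfolding E_def by simp
  have Nge: "k \<le> N k" for k
  proof -
    have "real k \<le> real (Suc k) ^ 1" by simp
    also have "\<dots> \<le> real (Suc k) ^ q" using q0 by (intro power_increasing) auto
    also have "\<dots> \<le> real (N k)" using EN[of k] Ele[of "N k"] by linarith
    finally show ?thesis by simp
  qed
  have Ninf: "filterlim N at_top sequentially"
    by (rule filterlim_at_top_mono[OF filterlim_ident]) (auto simp: Nge)
  define Y where "Y k x = ((\<Sum>i<N k. X i x) / E (N k) - 1)\<^sup>2" for k x
  have Y_eq: "Y k x = ((\<Sum>i<N k. X i x) - E (N k))\<^sup>2 / (E (N k))\<^sup>2" for k x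
    using EN1[of k] unfolding Y_def by (simp add: field_simps power2_eq_square)
  have intY: "integrable M (Y k)" for k
  proof (rule integrable_const_bound[where B="(real (N k) + 1)\<^sup>2"])
    have "\<bar>(\<Sum>i<N k. X i x) / E (N k) - 1\<bar> \<le> real (N k) + 1" for x
    proof -
      have s: "0 \<le> (\<Sum>i<N k. X i x)" "(\<Sum>i<N k. X i x) \<le> real (N k)"
        using X sum_bounded_above[of "{..<N k}" "\<lambda>i. X i x" 1] by (auto intro: sum_nonneg)
      have "(\<Sum>i<N k. X i x) / E (N k) \<le> real (N k) / 1"
        using s EN1[of k] by (intro frac_le) auto
      moreover have "0 \<le> (\<Sum>i<N k. X i x) / E (N k)" using s EN1[of k] by simp
      ultimately show ?thesis by linarith
    qed
    then show "AE x in M. norm (Y k x) \<le> (real (N k) + 1)\<^sup>2"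
      unfolding Y_def by (auto intro!: AE_I2 simp: abs_le_square_iff[symmetric])
  qed (unfold Y_def, measurable)
  have "eventually (\<lambda>k. norm (expectation (Y k)) \<le> \<bar>C\<bar> * inverse (real (Suc k) ^ 2)) sequentially"
    using filterlim_iff[THEN iffD1, OF Ninf, rule_format, OF var]
  proof eventually_elim
    case (elim k)
    have "E (N k) powr (2 - \<sigma>) / (E (N k))\<^sup>2 = E (N k) powr (- \<sigma>)"
      using EN1[of k] by (simp add: powr_diff powr_minus field_simps)
    also have "\<dots> \<le> (real (Suc k) ^ q) powr (- \<sigma>)"
      using EN[of k] \<open>0 < \<sigma>\<close> by (intro powr_mono2') auto
    also have "\<dots> = real (Suc k) powr (- (real q * \<sigma>))"
      by (simp add: powr_powr flip: powr_realpow)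
    also have "\<dots> \<le> real (Suc k) powr (-2)" using qs by (intro powr_mono) auto
    also have "\<dots> = inverse (real (Suc k) ^ 2)" by (simp add: powr_minus)
    finally have b: "E (N k) powr (2 - \<sigma>) / (E (N k))\<^sup>2 \<le> inverse (real (Suc k) ^ 2)" .
    have "expectation (Y k) \<le> C * E (N k) powr (2 - \<sigma>) / (E (N k))\<^sup>2"
      unfolding Y_eq using elim by (simp add: divide_right_mono)
    also have "\<dots> \<le> \<bar>C\<bar> * (E (N k) powr (2 - \<sigma>) / (E (N k))\<^sup>2)"
      by (simp add: divide_right_mono mult_right_mono)
    also have "\<dots> \<le> \<bar>C\<bar> * inverse (real (Suc k) ^ 2)" by (intro mult_left_mono b) auto
    finally show ?case by (simp add: Y_def integral_nonneg)
  qed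
  moreover have "summable (\<lambda>k. \<bar>C\<bar> * inverse (real (Suc k) ^ 2))"
    using summable_Suc_iff[THEN iffD2, OF inverse_power_summable[of 2, where 'a=real]]
    by (intro summable_mult) simp
  ultimately have "summable (\<lambda>k. expectation (Y k))"
    by (rule summable_comparison_test_ev)
  then have "AE x in M. (\<lambda>k. Y k x) \<longlonglongrightarrow> 0"
    by (rule AE_tendsto_0_if_summable_expectation[OF intY, rotated]) (simp add: Y_def)
  then show ?thesis
  proof eventually_elim
    case (elim x)
    have "(\<lambda>k. sqrt (Y k x)) \<longlonglongrightarrow> sqrt 0" by (intro tendsto_real_sqrt elim)
    then have "(\<lambda>k. (\<Sum>i<N k. X i x) / E (N k) - 1) \<longlonglongrightarrow> 0"
      unfolding Y_def by (simp add: tendsto_rabs_zero_iff)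
    then have SE: "(\<lambda>k. (\<Sum>i<N k. X i x) / E (N k)) \<longlonglongrightarrow> 1" by (simp add: LIM_zero_iff)
    have Emono: "mono E" unfolding E_def by (intro monoI sum_mono2) (auto simp: mX)
    \<comment> \<open>The lower bound 1 is monotonicity; the upper bound compares the overshoot at
      level \<open>Suc k\<close> with level \<open>k\<close>, and consecutive \<open>q\<close>-th
      powers have ratio tending to 1.\<close>
    have EE: "(\<lambda>k. E (N (Suc k)) / E (N k)) \<longlonglongrightarrow> 1"
    proof (rule tendsto_sandwich[where f="\<lambda>_. 1"])
      have "(\<lambda>k. ((real k + 2) / (real k + 1)) ^ q + inverse ((real k + 1) ^ q)) \<longlonglongrightarrow> 1 ^ q + 0"
      proof (intro tendsto_add tendsto_power)
        have "(\<lambda>k. 1 + inverse (real (Suc k))) \<longlonglongrightarrow> 1 + 0"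
          by (intro tendsto_intros LIMSEQ_inverse_real_of_nat)
        moreover have "1 + inverse (real (Suc k)) = (real k + 2) / (real k + 1)" for k
          by (simp add: field_simps)
        ultimately show "(\<lambda>k. (real k + 2) / (real k + 1)) \<longlonglongrightarrow> 1" by simp
        have "(\<lambda>k. inverse (real (Suc k)) ^ q) \<longlonglongrightarrow> 0 ^ q"
          by (intro tendsto_intros LIMSEQ_inverse_real_of_nat)
        then show "(\<lambda>k. inverse ((real k + 1) ^ q)) \<longlonglongrightarrow> 0"
          using q0 by (simp add: power_inverse add.commute zero_power)
      qed
      then show "(\<lambda>k. ((real k + 2) / (real k + 1)) ^ q + inverse ((real k + 1) ^ q)) \<longlonglongrightarrow> 1"
        by simp
      have "E (N (Suc k)) / E (N k) \<le> ((real k + 2) / (real k + 1)) ^ q + inverse ((real k + 1) ^ q)"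
        for k
      proof -
        have "E (N (Suc k)) / E (N k) \<le> (real (Suc (Suc k)) ^ q + 1) / (real (Suc k) ^ q)"
          using EN'[of "Suc k"] EN[of k] by (intro frac_le) auto
        also have "\<dots> = ((real k + 2) / (real k + 1)) ^ q + inverse ((real k + 1) ^ q)"
          unfolding power_divide by (simp add: add_divide_distrib inverse_eq_divide add.commute)
        finally show ?thesis .
      qed
      then show "eventually (\<lambda>k. E (N (Suc k)) / E (N k)
          \<le> ((real k + 2) / (real k + 1)) ^ q + inverse ((real k + 1) ^ q)) sequentially" by simp
      have "1 \<le> E (N (Suc k)) / E (N k)" for k
      proof -
        have "N k \<le> N (Suc k)"
          unfolding N_def[of k]
          by (rule Least_le, rule order_trans[OF _ EN]) (auto intro: power_mono)
        then show ?thesis using monoD[OF Emono, of "N k" "N (Suc k)"] EN1[of k] by simp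
      qed
      then show "eventually (\<lambda>k. 1 \<le> E (N (Suc k)) / E (N k)) sequentially" by simp
    qed simp
    show ?case
    proof (rule tendsto_ratio_interpolate[where N=N and E=E])
      show "mono (\<lambda>n. \<Sum>i<n. X i x)" by (intro monoI sum_mono2) (auto simp: X)
      show "0 < E (N k)" for k using EN1[of k] by linarith
    qed (use X Emono SE EE Ninf in \<open>auto intro: sum_nonneg\<close>)
  qed
qed

section \<open>Second moments and sums of covariances\<close>

text \<open>Groups the covariances by the later of the two times, since the trivial bound is in
  terms of the later ball.\<close>

lemma sum_square_symmetric:
  fixes c :: "nat \<Rightarrow> nat \<Rightarrow> real"
  assumes "\<And>i j. c i j = c j i"
  shows "(\<Sum>i<n. \<Sum>j<n. c i j) = (\<Sum>j<n. c j j + 2 * (\<Sum>i<j. c i j))"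
proof (induction n)
  case (Suc n)
  have "(\<Sum>j<n. c n j) = (\<Sum>i<n. c i n)" by (rule sum.cong) (auto simp: assms)
  with Suc show ?case by (simp add: sum.distrib)
qed simp

lemma (in prob_space) second_moment_centered_sum:
  fixes X :: "nat \<Rightarrow> 'a \<Rightarrow> real"
  assumes "\<And>i. integrable M (X i)" and "\<And>i j. integrable M (\<lambda>x. X i x * X j x)"
  shows "expectation (\<lambda>x. ((\<Sum>i<n. X i x) - (\<Sum>i<n. expectation (X i)))\<^sup>2)
    = (\<Sum>i<n. \<Sum>j<n. expectation (\<lambda>x. X i x * X j x) - expectation (X i) * expectation (X j))"
proof -
  define m where "m i = expectation (X i)" for i
  have e: "expectation (\<lambda>x. (X i x - m i) * (X j x - m j)) = expectation (\<lambda>x. X i x * X j x) - m i * m j"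
    for i j
  proof -
    have "(\<lambda>x. (X i x - m i) * (X j x - m j))
        = (\<lambda>x. X i x * X j x - m j * X i x - m i * X j x + m i * m j)"
      by (auto simp: algebra_simps)
    then show ?thesis using assms prob_space by (simp add: m_def)
  qed
  have i: "integrable M (\<lambda>x. (X i x - m i) * (X j x - m j))" for i j
  proof -
    have "(\<lambda>x. (X i x - m i) * (X j x - m j))
        = (\<lambda>x. X i x * X j x - m j * X i x - m i * X j x + m i * m j)"
      by (auto simp: algebra_simps)
    then show ?thesis using assms by simp
  qed
  have "(\<lambda>x. ((\<Sum>i<n. X i x) - (\<Sum>i<n. m i))\<^sup>2)
      = (\<lambda>x. \<Sum>i<n. \<Sum>j<n. (X i x - m i) * (X j x - m j))"
    by (simp add: power2_eq_square sum_product flip: sum_subtractf)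
  then show ?thesis using i by (simp add: e flip: m_def)
qed

text \<open>For fixed \<open>j\<close>, at most \<open>i0\<close> early indices and at most
  \<open>K\<close> indices with a short gap cost \<open>m j\<close> each; all others obey the
  long-gap estimate. There \<open>a\<close> and \<open>b\<close> stand for collar errors, and
  \<open>g * w\<close> for the decay error with \<open>w\<close> summable over the gaps.\<close>

lemma covariance_sum_le:
  fixes c :: "nat \<Rightarrow> nat \<Rightarrow> real" and m w :: "nat \<Rightarrow> real"
  defines "E \<equiv> \<lambda>n. \<Sum>i<n. m i"
  assumes sym: "\<And>i j. c i j = c j i"
    and m: "\<And>i. 0 \<le> m i" and c: "\<And>i j. i \<le> j \<Longrightarrow> c i j \<le> m j"
    and far: "\<And>i j. i0 \<le> i \<Longrightarrow> i < j \<Longrightarrow> K < real (j - i) \<Longrightarrow>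
      c i j \<le> a * (m i + m j) + b + g * w (j - i)"
    and nonneg: "0 \<le> a" "0 \<le> b" "0 \<le> g" "0 \<le> K" "\<And>k. 0 \<le> w k"
    and Z: "\<And>n. (\<Sum>k=1..n. w k) \<le> Z"
  shows "(\<Sum>i<n. \<Sum>j<n. c i j)
    \<le> E n + 2 * ((real i0 + K) * E n + 2 * a * real n * E n + b * (real n)\<^sup>2 + g * Z * real n)"
proof -
  have E0: "0 \<le> E n" unfolding E_def by (intro sum_nonneg m)
  have inner: "(\<Sum>i<j. c i j) \<le> (real i0 + K) * m j + a * E n + a * real n * m j + b * real n + g * Z"
    if j: "j < n" for j
  proof -
    \<comment> \<open>\<open>?p\<close> pays for the early indices and \<open>?q\<close> for the
      short gaps. The long-gap terms are nonnegative, so they can be added for every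
      \<open>i\<close> and no case split survives in the sum.\<close>
    let ?p = "\<lambda>i. if i < i0 then m j else 0" and ?q = "\<lambda>i. if real (j - i) \<le> K then m j else 0"
    have "(\<Sum>i<j. c i j) \<le> (\<Sum>i<j. ?p i + ?q i + (a * m i + a * m j + b) + g * w (j - i))"
    proof (rule sum_mono)
      fix i assume "i \<in> {..<j}"
      then have ij: "i < j" by simp
      have "0 \<le> a * m i" "0 \<le> a * m j" "0 \<le> g * w (j - i)" using nonneg m by simp_all
      then show "c i j \<le> ?p i + ?q i + (a * m i + a * m j + b) + g * w (j - i)"
        using c[of i j] far[of i j] ij m[of j] nonneg(2) by (auto simp: algebra_simps not_less)
    qed
    also have "\<dots> = (\<Sum>i<j. ?p i) + (\<Sum>i<j. ?q i) + (a * E j + a * real j * m j + b * real j)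
        + g * (\<Sum>i<j. w (j - i))"
      by (simp add: sum.distrib sum_distrib_left E_def algebra_simps)
    also have "\<dots> \<le> real i0 * m j + K * m j + (a * E n + a * real n * m j + b * real n) + g * Z"
    proof (intro add_mono mult_left_mono)
      have "(\<Sum>i<j. ?p i) = real (card ({..<j} \<inter> {..<i0})) * m j"
        by (simp add: sum.If_cases lessThan_def)
      also have "card ({..<j} \<inter> {..<i0}) \<le> card {..<i0}" by (intro card_mono) auto
      then have "real (card ({..<j} \<inter> {..<i0})) * m j \<le> real i0 * m j"
        by (intro mult_right_mono m) auto
      finally show "(\<Sum>i<j. ?p i) \<le> real i0 * m j" .
      \<comment> \<open>Gaps are positive integers, so those of size at most \<open>K\<close> number
        at most the floor of \<open>K\<close>.\<close>
      let ?S = "{..<j} \<inter> {i. real (j - i) \<le> K}"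
      have "?S \<subseteq> (\<lambda>k. j - k) ` {1..nat \<lfloor>K\<rfloor>}"
      proof
        fix i assume "i \<in> ?S"
        then have "j - i \<in> {1..nat \<lfloor>K\<rfloor>}" "i = j - (j - i)" by (auto simp: le_nat_iff le_floor_iff)
        then show "i \<in> (\<lambda>k. j - k) ` {1..nat \<lfloor>K\<rfloor>}" by blast
      qed
      then have "card ?S \<le> card {1..nat \<lfloor>K\<rfloor>}" by (rule surj_card_le[rotated]) simp
      also have "\<dots> = nat \<lfloor>K\<rfloor>" by simp
      finally have "real (card ?S) \<le> K" using nonneg(4) by linarith
      then have "real (card ?S) * m j \<le> K * m j" by (intro mult_right_mono m)
      moreover have "(\<Sum>i<j. ?q i) = real (card ?S) * m j" by (subst sum.If_cases) auto
      ultimately show "(\<Sum>i<j. ?q i) \<le> K * m j" by (simp only:)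
      show "E j \<le> E n" unfolding E_def using j by (intro sum_mono2) (auto simp: m)
      show "a * real j * m j \<le> a * real n * m j"
        using j nonneg by (intro mult_right_mono mult_left_mono m) auto
      have "(\<Sum>i<j. w (j - i)) = (\<Sum>k=1..j. w k)"
        by (rule sum.reindex_bij_witness[where i="\<lambda>k. j - k" and j="\<lambda>i. j - i"]) auto
      then show "(\<Sum>i<j. w (j - i)) \<le> Z" using Z[of j] by simp
    qed (use j nonneg in auto)
    finally show ?thesis by (simp add: algebra_simps)
  qed
  have "(\<Sum>i<n. \<Sum>j<n. c i j) \<le> (\<Sum>j<n. m j + 2 * ((real i0 + K) * m j + a * E n
      + a * real n * m j + b * real n + g * Z))"
    unfolding sum_square_symmetric[where c=c and n=n, OF sym] by (intro sum_mono add_mono mult_left_mono c inner) auto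
  \<comment> \<open>Summed over \<open>j\<close>, both \<open>a * E n\<close> and
    \<open>a * real n * m j\<close> give \<open>a * real n * E n\<close>; hence the factor 2 in
    front of \<open>a\<close>.\<close>
  also have "\<dots> = E n + 2 * ((real i0 + K) * E n + 2 * a * real n * E n + b * (real n)\<^sup>2 + g * Z * real n)"
    unfolding E_def by (simp add: sum.distrib algebra_simps power2_eq_square flip: sum_distrib_left sum_distrib_right)
  finally show ?thesis .
qed

section \<open>Growth of the normalising sums and balancing of the parameters\<close>

text \<open>At least half of the indices below \<open>n\<close> lie in the range of the hypothesis,
  and each contributes at least \<open>real n powr (- \<beta>)\<close>.\<close>

lemma powr_one_minus_le_sum:
  fixes m :: "nat \<Rightarrow> real"
  assumes m: "\<And>i. 0 \<le> m i" and ev: "eventually (\<lambda>i. real i powr (- \<beta>) \<le> m i) sequentially"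
    and "0 < \<beta>"
  shows "eventually (\<lambda>n. real n powr (1 - \<beta>) / 2 \<le> (\<Sum>i<n. m i)) sequentially"
proof -
  obtain i0 where i0: "\<And>i. i \<ge> i0 \<Longrightarrow> real i powr (- \<beta>) \<le> m i"
    using ev unfolding eventually_sequentially by auto
  \<comment> \<open>The threshold gives \<open>n - (i0 + 1) \<ge> n / 2\<close>. Starting the sum at
    \<open>i0 + 1\<close> avoids the index 0, where \<open>powr\<close> takes the value 0 and
    antitonicity fails.\<close>
  have "real n powr (1 - \<beta>) / 2 \<le> (\<Sum>i<n. m i)" if n: "n \<ge> 2 * i0 + 2" for n
  proof -
    have "real n powr (1 - \<beta>) / 2 = (real n / 2) * real n powr (- \<beta>)"
      using n by (simp add: powr_diff powr_minus field_simps)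
    also have "\<dots> \<le> real (n - (i0 + 1)) * real n powr (- \<beta>)"
      using n by (intro mult_right_mono) auto
    also have "\<dots> = (\<Sum>i\<in>{i0+1..<n}. real n powr (- \<beta>))" by simp
    also have "\<dots> \<le> (\<Sum>i\<in>{i0+1..<n}. m i)"
    proof (rule sum_mono)
      fix i assume i: "i \<in> {i0+1..<n}"
      then have "real n powr (- \<beta>) \<le> real i powr (- \<beta>)" using \<open>0 < \<beta>\<close> by (intro powr_mono2') auto
      also have "\<dots> \<le> m i" using i by (intro i0) auto
      finally show "real n powr (- \<beta>) \<le> m i" .
    qed
    also have "\<dots> \<le> (\<Sum>i<n. m i)" by (intro sum_mono2) (auto simp: m)
    finally show ?thesis .
  qed
  then show ?thesis unfolding eventually_sequentially by blast
qed

lemma sum_powr_bounded: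
  fixes s :: real
  assumes "1 < s"
  obtains Z where "0 < Z" "\<And>n. (\<Sum>k=1..n. real k powr (- s)) \<le> Z"
proof -
  have sm: "summable (\<lambda>k. real k powr (- s))" using assms by (simp add: summable_real_powr_iff)
  have "(\<Sum>k=1..n. real k powr (- s)) \<le> (\<Sum>k. real k powr (- s)) + 1" for n
    using sum_le_suminf[OF sm, of "{1..n}"] by simp
  moreover have "0 < (\<Sum>k. real k powr (- s)) + 1" using suminf_nonneg[OF sm] by simp
  ultimately show ?thesis using that by blast
qed

text \<open>
  Here \<open>E\<close> stands for the sum of the first \<open>n\<close> measures, \<open>K\<close> for the cut-off between short
  and long gaps, and \<open>e\<close> for the collar thickness. They are balanced so that every error term
  is \<open>O(E\<^sup>2 n powr (- \<sigma>))\<close>; the lower bound on \<open>E\<close> and the value of \<open>\<alpha>\<close> give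
  \<open>n powr (2 + 2 / \<delta> - \<beta>) = O(E powr (\<alpha> + 2))\<close>, which controls the decay term.
\<close>

lemma balanced_bound:
  fixes E \<alpha> \<beta> \<delta> A B Z :: real and n i0 :: nat
  assumes \<delta>: "0 < \<delta>" and \<beta>: "0 < \<beta>" "\<beta> < 1" and \<alpha>: "\<alpha> = (2 / \<delta> + \<beta>) / (1 - \<beta>)"
    and n: "1 \<le> n" and E: "real n powr (1 - \<beta>) / 2 \<le> E" "E \<le> real n"
    and nonneg: "0 \<le> A" "0 \<le> B" "0 \<le> Z"
  defines "\<sigma> \<equiv> (1 - \<beta>) / (1 + \<alpha>)"
  defines "K \<equiv> E * real n powr (- \<sigma>)"
  defines "e \<equiv> (E * real n powr (- 1 - \<sigma>)) powr (1 / \<delta>) / 2"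
  shows "0 < \<sigma>" "0 < K" "0 < e" "e \<le> 1 / 2"
    and "E + 2 * ((real i0 + K) * E + 2 * (A * e powr \<delta>) * real n * E + (A * e powr \<delta>)\<^sup>2 * (real n)\<^sup>2
        + (B * e powr (-2) * K powr (2 / \<delta> - \<alpha>)) * Z * real n)
      \<le> (2 + 2 * (2 * real i0 + 1 + 2 * A + A\<^sup>2 + 2 powr (\<alpha> + 2) * 4 * B * Z)) * E powr (2 - \<sigma>)"
proof -
  define x where "x = real n"
  have x: "1 \<le> x" using n by (simp add: x_def)
  have xp: "0 < x powr t" for t using x by simp
  have Ex: "x powr (1 - \<beta>) / 2 \<le> E" "E \<le> x" using E by (simp_all add: x_def)
  have E0: "0 < E" using Ex(1) xp[of "1 - \<beta>"] by linarith
  have \<alpha>0: "0 < \<alpha>" unfolding \<alpha> using \<delta> \<beta> by (simp add: add_pos_pos)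
  show \<sigma>0: "0 < \<sigma>" unfolding \<sigma>_def using \<alpha>0 \<beta> by simp
  have \<sigma>\<beta>: "\<sigma> \<le> 1 - \<beta>" unfolding \<sigma>_def using \<alpha>0 \<beta> by (simp add: field_simps)
  \<comment> \<open>This equation dictates the value of \<sigma>: with it the exponent of
    \<open>x\<close> in the decay term \<open>T5\<close> becomes exactly
    \<open>(1 - \<beta>) * (\<alpha> + 2) - \<sigma>\<close>.\<close>
  have \<beta>_eq: "\<beta> = 1 - \<sigma> * (1 + \<alpha>)" unfolding \<sigma>_def using \<alpha>0 by simp
  have \<alpha>\<beta>: "(1 - \<beta>) * (\<alpha> + 2) = 2 + 2 / \<delta> - \<beta>"
  proof -
    have "(1 - \<beta>) * \<alpha> = 2 / \<delta> + \<beta>" unfolding \<alpha> using \<beta> by simp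
    then show ?thesis by (simp add: algebra_simps)
  qed
  have K_eq: "K = E * x powr (- \<sigma>)" by (simp add: K_def x_def)
  show K0: "0 < K" unfolding K_eq using E0 xp by simp
  \<comment> \<open>\<open>v\<close> dominates \<open>e powr \<delta>\<close>, the scale of the
    measure of a collar, and \<open>v * x = K\<close>. Over \<open>x\<close> indices the collars
    thus cost no more than the short gaps.\<close>
  define v where "v = E * x powr (- 1 - \<sigma>)"
  have v0: "0 < v" unfolding v_def using E0 xp by simp
  have vx: "v * x = E * x powr (- \<sigma>)"
  proof -
    have "x powr (- 1 - \<sigma>) * x = x powr (- \<sigma>)" using x by (simp add: powr_diff powr_minus field_simps)
    then show ?thesis by (simp add: v_def)
  qed
  have xs1: "x powr (- \<sigma>) \<le> 1" using powr_mono[of "- \<sigma>" 0 x] x \<sigma>0 by simp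
  have "v * x \<le> 1 * x" unfolding vx using Ex(2) xs1 E0 xp[of "-\<sigma>"] mult_mono[of E x "x powr - \<sigma>" 1] x by simp
  then have v1: "v \<le> 1" using x by (simp only: mult_le_cancel_right)
  have e_eq: "e = v powr (1 / \<delta>) / 2" by (simp add: e_def v_def x_def)
  show "0 < e" unfolding e_eq using v0 by simp
  have "v powr (1 / \<delta>) \<le> 1" using v0 v1 \<delta> by (intro powr_le1) auto
  then show "e \<le> 1 / 2" unfolding e_eq by simp
  have ed: "e powr \<delta> \<le> v"
  proof -
    have "e powr \<delta> \<le> (v powr (1 / \<delta>)) powr \<delta>" unfolding e_eq using \<delta> by (intro powr_mono2) auto
    then show ?thesis using \<delta> v0 by (simp add: powr_powr)
  qed
  have e2: "e powr (-2) = 4 * v powr (- 2 / \<delta>)"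
  proof -
    have "e powr (-2) = (v powr (1 / \<delta>)) powr (-2) / 2 powr (-2)"
      unfolding e_eq by (rule powr_divide)
    also have "2 powr (-2 :: real) = 1 / 4" by (simp add: powr_minus)
    finally show ?thesis by (simp add: powr_powr)
  qed
  \<comment> \<open>The common scale: each of the terms below is at most a constant times
    \<open>Q\<close>.\<close>
  define Q where "Q = E\<^sup>2 * x powr (- \<sigma>)"
  have Q0: "0 \<le> Q" unfolding Q_def using xp[of "-\<sigma>"] by simp
  have EK: "K * E = Q" by (simp add: Q_def K_eq power2_eq_square)
  \<comment> \<open>The linear term is absorbed because \<sigma> is at most
    \<open>1 - \<beta>\<close>, so that \<open>E * x powr (- \<sigma>)\<close> is at least
    1/2.\<close>
  have T1: "E \<le> 2 * Q"
  proof -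
    have "1 \<le> x powr (1 - \<beta> - \<sigma>)" using x \<sigma>\<beta> by (intro ge_one_powr_ge_zero) auto
    also have "\<dots> = x powr (1 - \<beta>) * x powr (- \<sigma>)" by (simp flip: powr_add)
    also have "\<dots> \<le> (2 * E) * x powr (- \<sigma>)" using Ex(1) by (intro mult_right_mono) auto
    finally have "E * 1 \<le> E * (2 * E * x powr (- \<sigma>))" using E0 by (intro mult_left_mono) auto
    then show ?thesis by (simp add: Q_def power2_eq_square mult_ac)
  qed
  have T3: "2 * (A * e powr \<delta>) * x * E \<le> 2 * A * Q"
  proof -
    have "2 * (A * e powr \<delta>) * x * E \<le> 2 * (A * v) * x * E"
      using ed nonneg E0 x by (intro mult_right_mono mult_left_mono) auto
    also have "\<dots> = 2 * A * ((v * x) * E)" by (simp add: mult_ac)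
    also have "\<dots> = 2 * A * Q" unfolding vx by (simp add: Q_def power2_eq_square mult_ac)
    finally show ?thesis .
  qed
  have T4: "(A * e powr \<delta>)\<^sup>2 * x\<^sup>2 \<le> A\<^sup>2 * Q"
  proof -
    have "(A * e powr \<delta>)\<^sup>2 * x\<^sup>2 = A\<^sup>2 * (e powr \<delta> * x)\<^sup>2" by (simp add: power_mult_distrib)
    also have "\<dots> \<le> A\<^sup>2 * (v * x)\<^sup>2"
      using ed x by (intro mult_left_mono power_mono mult_right_mono) auto
    also have "(v * x)\<^sup>2 = Q * x powr (- \<sigma>)" unfolding vx by (simp add: Q_def power2_eq_square mult_ac)
    also have "A\<^sup>2 * (Q * x powr (- \<sigma>)) \<le> A\<^sup>2 * (Q * 1)"
      using xs1 Q0 by (intro mult_left_mono) auto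
    finally show ?thesis by simp
  qed
  \<comment> \<open>The exponent \<open>- 2 / \<delta>\<close> of \<open>v\<close> cancels the
    \<open>2 / \<delta>\<close> in that of \<open>K\<close> and leaves
    \<open>E powr (- \<alpha>)\<close>. The lower bound on \<open>E\<close> then trades
    \<open>(x powr (1 - \<beta>)) powr (\<alpha> + 2)\<close> for a power of \<open>2 * E\<close>,
    so that \<open>E\<close> is squared in total.\<close>
  have T5: "v powr (- 2 / \<delta>) * K powr (2 / \<delta> - \<alpha>) * x \<le> 2 powr (\<alpha> + 2) * Q"
  proof -
    have "v powr (- 2 / \<delta>) * K powr (2 / \<delta> - \<alpha>) * x
        = (E powr (- 2 / \<delta>) * E powr (2 / \<delta> - \<alpha>))
          * (x powr ((- 1 - \<sigma>) * (- 2 / \<delta>)) * x powr ((- \<sigma>) * (2 / \<delta> - \<alpha>)) * x powr 1)"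
      unfolding v_def K_eq using x by (simp add: powr_mult powr_powr mult_ac)
    also have "\<dots> = E powr (- \<alpha>) * x powr ((- 1 - \<sigma>) * (- 2 / \<delta>) + (- \<sigma>) * (2 / \<delta> - \<alpha>) + 1)"
      by (simp only: powr_add[symmetric]) simp
    also have "(- 1 - \<sigma>) * (- 2 / \<delta>) + (- \<sigma>) * (2 / \<delta> - \<alpha>) + 1 = (1 - \<beta>) * (\<alpha> + 2) + (- \<sigma>)"
      unfolding \<alpha>\<beta> unfolding \<beta>_eq using \<delta> by (simp add: field_simps)
    also have "x powr ((1 - \<beta>) * (\<alpha> + 2) + (- \<sigma>)) = (x powr (1 - \<beta>)) powr (\<alpha> + 2) * x powr (- \<sigma>)"
      unfolding powr_powr by (rule powr_add)
    also have "E powr (- \<alpha>) * ((x powr (1 - \<beta>)) powr (\<alpha> + 2) * x powr (- \<sigma>))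
        \<le> E powr (- \<alpha>) * ((2 * E) powr (\<alpha> + 2) * x powr (- \<sigma>))"
      using Ex(1) \<alpha>0 by (intro mult_left_mono mult_right_mono powr_mono2) auto
    also have "\<dots> = 2 powr (\<alpha> + 2) * ((E powr (- \<alpha>) * E powr (\<alpha> + 2)) * x powr (- \<sigma>))"
      using E0 by (simp add: powr_mult mult_ac)
    also have "E powr (- \<alpha>) * E powr (\<alpha> + 2) = E\<^sup>2" using E0 by (simp flip: powr_add)
    finally show ?thesis by (simp add: Q_def)
  qed
  have T5': "B * e powr (-2) * K powr (2 / \<delta> - \<alpha>) * Z * x \<le> 2 powr (\<alpha> + 2) * 4 * B * Z * Q"
  proof -
    have "4 * B * Z * (v powr (- 2 / \<delta>) * K powr (2 / \<delta> - \<alpha>) * x) \<le> 4 * B * Z * (2 powr (\<alpha> + 2) * Q)"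
      using nonneg by (intro mult_left_mono T5) auto
    then show ?thesis unfolding e2 by (simp add: mult_ac)
  qed
  have i0E: "real i0 * E \<le> real i0 * (2 * Q)" by (intro mult_left_mono T1) auto
  define R where "R = 2 + 2 * (2 * real i0 + 1 + 2 * A + A\<^sup>2 + 2 powr (\<alpha> + 2) * 4 * B * Z)"
  have R0: "0 \<le> R" unfolding R_def using nonneg by simp
  have "E + 2 * ((real i0 + K) * E + 2 * (A * e powr \<delta>) * x * E + (A * e powr \<delta>)\<^sup>2 * x\<^sup>2
        + (B * e powr (-2) * K powr (2 / \<delta> - \<alpha>)) * Z * x)
      = E + 2 * (real i0 * E + K * E + 2 * (A * e powr \<delta>) * x * E + (A * e powr \<delta>)\<^sup>2 * x\<^sup>2
        + (B * e powr (-2) * K powr (2 / \<delta> - \<alpha>)) * Z * x)" by (simp add: algebra_simps)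
  also have "\<dots> \<le> 2 * Q + 2 * (real i0 * (2 * Q) + Q + 2 * A * Q + A\<^sup>2 * Q + 2 powr (\<alpha> + 2) * 4 * B * Z * Q)"
    by (intro add_mono mult_left_mono T1 i0E T3 T4 T5' eq_refl[OF EK]) auto
  also have "\<dots> = R * Q" by (simp add: R_def algebra_simps)
  also have "\<dots> \<le> R * E powr (2 - \<sigma>)"
  proof (intro mult_left_mono R0)
    \<comment> \<open>Here \<open>E \<le> x\<close> turns the gain in \<open>x\<close> into a gain
      in \<open>E\<close>, the form that the strong law requires.\<close>
    have "Q \<le> E\<^sup>2 * E powr (- \<sigma>)"
      unfolding Q_def using Ex(2) E0 \<sigma>0 by (intro mult_left_mono powr_mono2') auto
    also have "\<dots> = E powr (2 - \<sigma>)" using E0 by (simp add: powr_diff powr_minus field_simps)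
    finally show "Q \<le> E powr (2 - \<sigma>)" .
  qed
  finally show "E + 2 * ((real i0 + K) * E + 2 * (A * e powr \<delta>) * real n * E
        + (A * e powr \<delta>)\<^sup>2 * (real n)\<^sup>2 + (B * e powr (-2) * K powr (2 / \<delta> - \<alpha>)) * Z * real n)
      \<le> (2 + 2 * (2 * real i0 + 1 + 2 * A + A\<^sup>2 + 2 powr (\<alpha> + 2) * 4 * B * Z)) * E powr (2 - \<sigma>)"
    by (simp add: x_def R_def)
qed

section \<open>Invariance, Lipschitz cutoffs and correlations of balls\<close>

lemma measure_preserving_funpow:
  assumes "measure_preserving_map M T"
  shows "measure_preserving_map M (T ^^ n)"
proof (induction n)
  case 0
  show ?case by (simp add: measure_preserving_map_def distr_id id_def)
next
  case (Suc n)
  have "distr M M (T \<circ> T ^^ n) = distr (distr M M (T ^^ n)) M T"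
    using assms using Suc assms by (subst distr_distr) (auto simp: measure_preserving_map_def)
  also have "\<dots> = M" using Suc assms by (simp add: measure_preserving_map_def)
  finally show ?case
    using Suc assms unfolding measure_preserving_map_def funpow.simps by (blast intro: measurable_comp)
qed

lemma integral_measure_preserving:
  fixes f :: "'a \<Rightarrow> real"
  assumes "measure_preserving_map M T" and "f \<in> borel_measurable M"
  shows "(\<integral>x. f (T x) \<partial>M) = (\<integral>x. f x \<partial>M)"
  using integral_distr[of T M M f] assms by (simp add: measure_preserving_map_def)

text \<open>For \<open>e > 0\<close> this is the piecewise linear cutoff in the distance from
  \<open>x0\<close>: 1 up to distance \<open>r\<close>, 0 from distance \<open>r + e\<close> on,
  with slope \<open>- 1 / e\<close> between.\<close>

definition bump :: "'a::metric_space \<Rightarrow> real \<Rightarrow> real \<Rightarrow> 'a \<Rightarrow> real" where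
  "bump x0 r e x = max 0 (min 1 (1 - (dist x x0 - r) / e))"

lemma bump_bounds: "0 \<le> bump x0 r e x" "bump x0 r e x \<le> 1"
  by (auto simp: bump_def)

lemma indicator_ball_le_bump:
  assumes "0 < e"
  shows "indicator (ball x0 r) x \<le> bump x0 r e x"
proof -
  have "(dist x x0 - r) / e \<le> 0" if "dist x x0 < r"
    using that assms by (simp add: divide_nonpos_pos)
  then show ?thesis by (auto simp: indicator_def bump_def dist_commute)
qed

lemma bump_le_indicator_ball:
  assumes "0 < e"
  shows "bump x0 r e x \<le> indicator (ball x0 (r + e)) x"
proof -
  have "1 \<le> (dist x x0 - r) / e" if "r + e \<le> dist x x0" using that assms by simp
  then show ?thesis by (auto simp: indicator_def bump_def dist_commute not_less)
qed

text \<open>Clamping to the unit interval and the distance to \<open>x0\<close> are both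
  1-Lipschitz, so only the scaling by \<open>1 / e\<close> matters.\<close>

lemma bump_lipschitz:
  assumes "0 < e"
  shows "(1 / e)-lipschitz_on UNIV (bump x0 r e)"
proof (rule lipschitz_onI)
  fix x y :: 'a
  have "\<bar>bump x0 r e x - bump x0 r e y\<bar> \<le> \<bar>(dist x x0 - r) / e - (dist y x0 - r) / e\<bar>"
    unfolding bump_def by linarith
  also have "\<dots> = \<bar>dist x x0 - dist y x0\<bar> / e"
    using assms by (simp add: diff_divide_distrib[symmetric] abs_divide)
  also have "\<dots> \<le> dist x y / e"
    using assms abs_dist_diff_le[of x x0 y] by (intro divide_right_mono) (auto simp: dist_commute)
  finally show "dist (bump x0 r e x) (bump x0 r e y) \<le> 1 / e * dist x y" by (simp add: dist_real_def)
qed (use assms in simp)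

lemma bump_measurable: "0 < e \<Longrightarrow> bump x0 r e \<in> borel_measurable borel"
  by (intro borel_measurable_continuous_onI lipschitz_on_continuous_on[OF bump_lipschitz])

lemma bounded_lipschitz_bump: "0 < e \<Longrightarrow> bounded_lipschitz (bump x0 r e)"
  unfolding bounded_lipschitz_def using bump_lipschitz[of e x0 r] bump_bounds
  by (auto intro!: boundedI[of _ 1] simp: abs_le_iff order_trans[OF _ bump_bounds(1)])

text \<open>The supremum is at most 1, hence at most \<open>1 / e\<close> as
  \<open>e \<le> 1\<close>, and the least Lipschitz constant is at most \<open>1 / e\<close>.
  Nonnegativity serves to multiply two such bounds.\<close>

lemma lip_norm_bump:
  assumes "0 < e" "e \<le> 1"
  shows "0 \<le> lip_norm (bump x0 r e)" "lip_norm (bump x0 r e) \<le> 2 / e"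
proof -
  let ?L = "{L. L-lipschitz_on UNIV (bump x0 r e)}"
  have mem: "1 / e \<in> ?L" using bump_lipschitz[OF assms(1)] by simp
  have lb: "0 \<le> L" if "L \<in> ?L" for L using that by (auto intro: lipschitz_on_nonneg)
  have "Inf ?L \<le> 1 / e" by (rule cInf_lower[OF mem]) (use lb in \<open>rule bdd_belowI\<close>)
  moreover have "0 \<le> Inf ?L" by (rule cInf_greatest) (use mem lb in auto)
  moreover have b: "(SUP x. \<bar>bump x0 r e x\<bar>) \<le> 1"
    by (rule cSUP_least) (auto simp: bump_bounds abs_le_iff order_trans[OF _ bump_bounds(1)])
  moreover have "0 \<le> (SUP x. \<bar>bump x0 r e x\<bar>)"
    by (rule cSUP_upper2[of _ _ x0]) (auto simp: bump_bounds abs_le_iff intro!: bdd_aboveI[of _ 1] order_trans[OF _ bump_bounds(1)])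
  moreover have "1 \<le> 1 / e" using assms by simp
  ultimately show "0 \<le> lip_norm (bump x0 r e)" "lip_norm (bump x0 r e) \<le> 2 / e"
    unfolding lip_norm_def by (auto simp: field_simps)
qed

text \<open>
  The collar contains the sphere of radius \<open>r\<close>, which the open annuli of condition (A) reach
  only from a smaller inner radius; hence the factor \<open>2 powr \<delta>\<close>.
\<close>

lemma measure_ball_collar:
  fixes M :: "'a::metric_space measure"
  assumes "prob_space M" and [measurable_cong]: "sets M = sets borel"
    and A: "\<And>r \<epsilon>. 0 < r \<Longrightarrow> r \<le> r0 \<Longrightarrow> 0 < \<epsilon> \<Longrightarrow> \<epsilon> \<le> 1 \<Longrightarrow>
        measure M {x. r < dist x x0 \<and> dist x x0 < r + \<epsilon>} < C * \<epsilon> powr \<delta>"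
    and "0 < C" "0 < \<delta>" and r: "0 < r" "r \<le> r0" and e: "0 < e" "e \<le> 1 / 2"
  shows "measure M (ball x0 (r + e)) \<le> measure M (ball x0 r) + C * 2 powr \<delta> * e powr \<delta>"
proof -
  interpret prob_space M by fact
  \<comment> \<open>The inner radius is lowered by \<open>h\<close> to catch the sphere:
    \<open>h \<le> r / 2\<close> keeps it positive, and \<open>h \<le> e\<close> keeps the width at
    most \<open>2 * e \<le> 1\<close>, as condition (A) demands.\<close>
  define h where "h = min e (r / 2)"
  have h: "0 < h" "h \<le> e" "0 < r - h" using e r by (auto simp: h_def min_def)
  let ?R = "{x. r - h < dist x x0 \<and> dist x x0 < (r - h) + (e + h)}"
  have sets: "ball x0 t \<in> sets M" "?R \<in> sets M" for t
    unfolding assms(2) by (intro borel_open open_ball open_Collect_conj open_Collect_less continuous_intros)+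
  have "measure M (ball x0 (r + e)) \<le> measure M (ball x0 r \<union> ?R)"
    using h sets by (intro finite_measure_mono) (auto simp: dist_commute)
  also have "\<dots> \<le> measure M (ball x0 r) + measure M ?R"
    using sets by (intro measure_Un_le) auto
  also have "measure M ?R \<le> C * (e + h) powr \<delta>" using h r e by (intro less_imp_le[OF A]) auto
  also have "\<dots> \<le> C * (2 * e) powr \<delta>"
    using h e \<open>0 < C\<close> \<open>0 < \<delta>\<close> by (intro mult_left_mono powr_mono2) auto
  finally show ?thesis using e by (simp add: powr_mult mult_ac)
qed

text \<open>Bounding a variance from above calls only for an upper estimate, so both indicators are
  replaced by larger bumps, whose integrals are at most the measures of the enlarged balls. The
  factor \<open>4 * e powr (-2)\<close> is the product of two norm bounds
  \<open>2 / e\<close>.\<close>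

lemma integral_indicator_balls_le:
  fixes M :: "'a::metric_space measure"
  assumes "prob_space M" and sM: "sets M = sets borel" and T: "measure_preserving_map M T"
    and decay: "\<And>\<phi> \<psi>. bounded_lipschitz \<phi> \<Longrightarrow> bounded_lipschitz \<psi> \<Longrightarrow>
      \<bar>(\<integral>x. \<phi> (T x) * \<psi> x \<partial>M) - (\<integral>x. \<phi> x \<partial>M) * (\<integral>x. \<psi> x \<partial>M)\<bar> \<le> D * lip_norm \<phi> * lip_norm \<psi>"
    and "0 \<le> D" and e: "0 < e" "e \<le> 1"
    and a: "measure M (ball x0 (r + e)) \<le> a" and b: "measure M (ball y0 (s + e)) \<le> b"
  shows "(\<integral>x. indicator (ball x0 r) x * indicator (ball y0 s) (T x) \<partial>M) \<le> a * b + 4 * D * e powr (-2)"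
proof -
  interpret prob_space M by fact
  note [measurable_cong] = sM
  have Tm[measurable]: "T \<in> borel_measurable M"
    using T unfolding measure_preserving_map_def by (simp add: measurable_cong_sets[OF refl sM])
  note [measurable] = bump_measurable[OF e(1)]
  have ball[measurable]: "ball z t \<in> sets M" for z t by (simp add: sM)
  let ?f = "bump x0 r e" and ?g = "bump y0 s e"
  have abs1: "\<bar>bump z t e x\<bar> \<le> 1" for z t x using bump_bounds[of z t e x] by simp
  have int_bump: "integrable M (bump z t e)" for z t
    by (rule integrable_const_bound[where B=1]) (auto simp: abs1)
  have le: "(\<integral>x. bump z t e x \<partial>M) \<le> measure M (ball z (t + e))" for z t
  proof -
    have "(\<integral>x. bump z t e x \<partial>M) \<le> (\<integral>x. indicator (ball z (t + e)) x \<partial>M)"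
      by (intro integral_mono int_bump bump_le_indicator_ball[OF e(1)])
         (auto intro!: integrable_real_indicator simp: sM emeasure_eq_measure)
    then show ?thesis by (simp add: sets_eq_imp_space_eq[OF sM])
  qed
  have "(\<integral>x. indicator (ball x0 r) x * indicator (ball y0 s) (T x) \<partial>M) \<le> (\<integral>x. ?g (T x) * ?f x \<partial>M)"
  proof (rule integral_mono)
    show "integrable M (\<lambda>x. indicator (ball x0 r) x * indicator (ball y0 s) (T x) :: real)"
    proof (rule integrable_const_bound[where B=1])
      show "(\<lambda>x. indicator (ball x0 r) x * indicator (ball y0 s) (T x) :: real) \<in> borel_measurable M"
        using sM by measurable
    qed (auto simp: indicator_def)
    show "integrable M (\<lambda>x. ?g (T x) * ?f x)"
      by (rule integrable_const_bound[where B=1]) (auto simp: abs_mult abs1 intro!: mult_le_one)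
    show "indicator (ball x0 r) x * indicator (ball y0 s) (T x) \<le> ?g (T x) * ?f x" for x
      using indicator_ball_le_bump[OF e(1), of x0 r x] indicator_ball_le_bump[OF e(1), of y0 s "T x"]
      by (subst mult.commute, intro mult_mono) (auto simp: bump_bounds)
  qed
  also have "\<dots> \<le> (\<integral>x. ?g x \<partial>M) * (\<integral>x. ?f x \<partial>M) + D * lip_norm ?g * lip_norm ?f"
    using decay[of ?g ?f, OF bounded_lipschitz_bump[OF e(1)] bounded_lipschitz_bump[OF e(1)]]
    by linarith
  also have "\<dots> \<le> b * a + D * (2 / e) * (2 / e)"
  proof (intro add_mono mult_mono)
    show "(\<integral>x. ?g x \<partial>M) \<le> b" using le b by (rule order_trans)
    show "(\<integral>x. ?f x \<partial>M) \<le> a" using le a by (rule order_trans)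
    show "0 \<le> b" using b measure_nonneg by (rule order_trans[rotated])
  qed (use e \<open>0 \<le> D\<close> lip_norm_bump[OF e] in \<open>auto intro!: integral_nonneg simp: bump_bounds\<close>)
  also have "\<dots> = a * b + 4 * D * e powr (-2)"
    using e by (simp add: powr_minus power2_eq_square field_simps)
  finally show ?thesis .
qed

text \<open>For gaps \<open>x\<close> beyond \<open>K\<close> this extracts a factor independent of
  the gap; for \<open>s > 1\<close> the remaining factor is summable over the gaps.\<close>

lemma powr_decay_split:
  fixes \<alpha> s K x :: real
  assumes "0 < K" "K < x" "s \<le> \<alpha>"
  shows "x powr (- \<alpha>) \<le> K powr (s - \<alpha>) * x powr (- s)"
proof -
  have "x powr (- \<alpha>) = x powr (s - \<alpha>) * x powr (- s)" by (simp flip: powr_add)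
  also have "\<dots> \<le> K powr (s - \<alpha>) * x powr (- s)"
    using assms by (intro mult_right_mono powr_mono2') auto
  finally show ?thesis .
qed

section \<open>Variance of the number of hits and the strong law for balls\<close>

theorem corollary4:
  fixes M :: "'a::metric_space measure" and T :: "'a \<Rightarrow> 'a"
    and p :: "nat \<Rightarrow> 'a" and r :: "nat \<Rightarrow> real"
    and \<beta> \<gamma> \<delta> r0 :: real
  assumes "prob_space M" and "sets M = sets borel"
    and "measure_preserving_map M T"
    and "0 < \<delta>" and "\<delta> < 2"
    and "\<And>i. 0 < r i"
    and "condition_A M \<delta> r0 (condition_A_points p r)"
    and "eventually (\<lambda>i. r i \<le> r0) sequentially"
    and "0 < \<beta>" and "\<beta> < 1"
    and "\<gamma> > 1 + (2 - \<delta>) * (1 - \<beta>) / (2 + \<delta>)"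
    and "eventually (\<lambda>i. measure M (ball (p i) (r i))
           \<ge> real i powr (- \<beta>) * ln (real i) powr \<gamma>) sequentially"
    and "polynomial_decay M T ((2 / \<delta> + \<beta>) / (1 - \<beta>))"
  shows "AE x in M. (\<lambda>n. (\<Sum>i<n. indicator (ball (p i) (r i)) ((T ^^ i) x) :: real)
           / (\<Sum>i<n. measure M (ball (p i) (r i)))) \<longlonglongrightarrow> 1"
proof -
  interpret prob_space M by fact
  note sM[measurable_cong] = assms(2)
  have spM: "space M = UNIV" using sets_eq_imp_space_eq[OF sM] by simp
  note \<delta> = assms(4,5) and \<beta> = assms(9,10)
  define \<alpha> where "\<alpha> = (2 / \<delta> + \<beta>) / (1 - \<beta>)"
  \<comment> \<open>The part of the decay exponent reserved for summing over gaps: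
    \<open>\<delta> < 2\<close> makes it exceed 1, and the value \<open>2 / \<delta>\<close> is the
    one matched to the collar thickness.\<close>
  define s where "s = 2 / \<delta>"
  have s1: "1 < s" using \<delta> by (simp add: s_def)
  have s\<alpha>: "s \<le> \<alpha>"
  proof -
    have "s * (1 - \<beta>) \<le> s * 1" using s1 \<beta> by (intro mult_left_mono) auto
    then show ?thesis using \<beta> unfolding \<alpha>_def s_def[symmetric] by (simp add: pos_le_divide_eq)
  qed
  define B where "B i = ball (p i) (r i)" for i
  define m where "m i = measure M (B i)" for i
  define X where "X i x = (indicator (B i) ((T ^^ i) x) :: real)" for i x
  define E where "E n = (\<Sum>i<n. m i)" for n
  have Tn: "measure_preserving_map M (T ^^ n)" for n
    by (rule measure_preserving_funpow[OF assms(3)])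
  have Tn_meas[measurable]: "T ^^ n \<in> measurable M M" for n
    using Tn[of n] by (simp add: measure_preserving_map_def)
  have B_sets[measurable]: "B i \<in> sets M" for i by (simp add: B_def sM)
  have X_meas[measurable]: "X i \<in> borel_measurable M" for i unfolding X_def by measurable
  have X01: "0 \<le> X i x" "X i x \<le> 1" for i x by (auto simp: X_def indicator_def)
  have X1: "\<bar>X i x\<bar> \<le> 1" for i x using X01[of i x] by simp
  have intX: "integrable M (X i)" for i
    by (rule integrable_const_bound[where B=1]) (auto simp: X1)
  have intXX: "integrable M (\<lambda>x. X i x * X j x)" for i j
    by (rule integrable_const_bound[where B=1]) (auto simp: abs_mult X1 intro!: mult_le_one)
  have EX: "expectation (X i) = m i" for i
    using integral_measure_preserving[OF Tn, of "indicator (B i)" i]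
    by (simp add: X_def[abs_def] m_def spM)
  have m: "0 \<le> m i" "m i \<le> 1" for i by (simp_all add: m_def)
  define c where "c i j = expectation (\<lambda>x. X i x * X j x) - m i * m j" for i j
  have c_sym: "c i j = c j i" for i j by (simp add: c_def mult.commute)
  have c_triv: "c i j \<le> m j" for i j
  proof -
    have "expectation (\<lambda>x. X i x * X j x) \<le> expectation (X j)"
      by (intro integral_mono intXX intX) (use X01 in \<open>simp add: mult_left_le_one_le\<close>)
    moreover have "0 \<le> m i * m j" using m by simp
    ultimately show ?thesis by (simp add: c_def EX)
  qed

  \<comment> \<open>Either all centres equal \<open>p 0\<close> or the set is \<open>UNIV\<close>;
    in both cases condition (A) is available at every centre.\<close>
  have p_mem: "p i \<in> condition_A_points p r" for i by (auto simp: condition_A_points_def)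
  obtain CA where CA: "0 < CA" and condA: "\<And>x0 t \<epsilon>. x0 \<in> condition_A_points p r \<Longrightarrow> 0 < t \<Longrightarrow> t \<le> r0 \<Longrightarrow>
      0 < \<epsilon> \<Longrightarrow> \<epsilon> \<le> 1 \<Longrightarrow> measure M {x. t < dist x x0 \<and> dist x x0 < t + \<epsilon>} < CA * \<epsilon> powr \<delta>"
    using assms(7) unfolding condition_A_def by blast
  obtain D where D: "0 < D" and decay: "\<And>\<phi> \<psi> n. bounded_lipschitz \<phi> \<Longrightarrow> bounded_lipschitz \<psi> \<Longrightarrow> 1 \<le> n \<Longrightarrow>
      \<bar>(\<integral>x. \<phi> ((T ^^ n) x) * \<psi> x \<partial>M) - (\<integral>x. \<phi> x \<partial>M) * (\<integral>x. \<psi> x \<partial>M)\<bar>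
        \<le> D * real n powr (- \<alpha>) * lip_norm \<phi> * lip_norm \<psi>"
    using assms(13) unfolding polynomial_decay_def \<alpha>_def[symmetric] by blast
  obtain i0 where i0: "\<And>i. i0 \<le> i \<Longrightarrow> r i \<le> r0"
    using assms(8) unfolding eventually_sequentially by blast
  define A where "A = CA * 2 powr \<delta>"
  have A0: "0 \<le> A" using CA by (simp add: A_def)
  have far: "c i j \<le> (A * e powr \<delta>) * (m i + m j) + (A * e powr \<delta>)\<^sup>2
      + 4 * D * e powr (-2) * real (j - i) powr (- \<alpha>)"
    if ij: "i0 \<le> i" "i < j" and e: "0 < e" "e \<le> 1 / 2" for i j e
  proof -
    have collar: "measure M (ball (p k) (r k + e)) \<le> m k + A * e powr \<delta>" if "i0 \<le> k" for k
      using measure_ball_collar[OF assms(1,2) condA[OF p_mem] CA \<delta>(1) assms(6) i0[OF that] e]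
      by (simp add: m_def B_def A_def)
    \<comment> \<open>Invariance under \<open>T ^^ i\<close> moves the earlier hit to time 0, so
      that only the gap \<open>j - i\<close> matters.\<close>
    have "expectation (\<lambda>x. X i x * X j x)
        = (\<integral>x. (\<lambda>y. indicator (B i) y * indicator (B j) ((T ^^ (j - i)) y)) ((T ^^ i) x) \<partial>M)"
    proof (rule Bochner_Integration.integral_cong)
      show "X i x * X j x = (\<lambda>y. indicator (B i) y * indicator (B j) ((T ^^ (j - i)) y)) ((T ^^ i) x)" for x
        using ij(2) funpow_add[of "j - i" i T] by (simp add: X_def)
    qed simp
    also have "\<dots> = (\<integral>y. indicator (B i) y * indicator (B j) ((T ^^ (j - i)) y) \<partial>M)"
      by (rule integral_measure_preserving[OF Tn]) measurable
    also have "\<dots> \<le> (m i + A * e powr \<delta>) * (m j + A * e powr \<delta>)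
        + 4 * (D * real (j - i) powr (- \<alpha>)) * e powr (-2)"
      unfolding B_def using ij D e
      by (intro integral_indicator_balls_le[OF assms(1,2) Tn] collar decay) auto
    finally show ?thesis by (simp add: c_def algebra_simps power2_eq_square)
  qed

  obtain Z where Z: "0 < Z" "\<And>n. (\<Sum>k=1..n. real k powr (- s)) \<le> Z"
    using sum_powr_bounded[OF s1] by blast
  \<comment> \<open>From \<open>i = 3\<close> on the logarithm is at least 1, and \<gamma> is
    nonnegative, so the logarithmic factor is at least 1.\<close>
  have "eventually (\<lambda>i. real i powr (- \<beta>) \<le> m i) sequentially"
    using assms(12) eventually_ge_at_top[of 3]
  proof eventually_elim
    case (elim i)
    have "exp 1 \<le> real i" using elim(2) exp_le by linarith
    then have "1 \<le> ln (real i)" using elim(2) by (simp add: ln_ge_iff)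
    moreover have "0 \<le> \<gamma>"
    proof -
      have "0 \<le> (2 - \<delta>) * (1 - \<beta>) / (2 + \<delta>)" using \<delta> \<beta> by simp
      then show ?thesis using assms(11) by linarith
    qed
    ultimately have "real i powr (- \<beta>) * 1 \<le> real i powr (- \<beta>) * ln (real i) powr \<gamma>"
      by (intro mult_left_mono ge_one_powr_ge_zero) auto
    then show ?case using elim(1) by (simp add: m_def B_def)
  qed
  then have E_lower: "eventually (\<lambda>n. real n powr (1 - \<beta>) / 2 \<le> E n) sequentially"
    unfolding E_def using powr_one_minus_le_sum m(1) \<beta>(1) by blast
  have E_upper: "E n \<le> real n" for n
    using sum_bounded_above[of "{..<n}" m 1] m by (simp add: E_def)
  have E_lim: "filterlim E at_top sequentially"
  proof (rule filterlim_at_top_mono[OF _ E_lower])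
    show "filterlim (\<lambda>n. real n powr (1 - \<beta>) / 2) at_top sequentially"
      using \<beta> by real_asymp
  qed
  define \<sigma> where "\<sigma> = (1 - \<beta>) / (1 + \<alpha>)"
  \<comment> \<open>The constant of \<open>balanced_bound\<close> for \<open>B = 4 * D\<close>; it
    is independent of \<open>n\<close>.\<close>
  define R where "R = 2 + 2 * (2 * real i0 + 1 + 2 * A + A\<^sup>2 + 2 powr (\<alpha> + 2) * 4 * (4 * D) * Z)"
  have "eventually (\<lambda>n. expectation (\<lambda>x. ((\<Sum>i<n. X i x) - (\<Sum>i<n. expectation (X i)))\<^sup>2)
      \<le> R * (\<Sum>i<n. expectation (X i)) powr (2 - \<sigma>)) sequentially"
    using E_lower eventually_ge_at_top[of 1]
  proof eventually_elim
    case (elim n)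
    \<comment> \<open>Cut-off and collar thickness depend on \<open>n\<close> alone: one choice
      serves all pairs of times below \<open>n\<close>, which is possible as \<open>far\<close>
      holds for every admissible thickness.\<close>
    define K where "K = E n * real n powr (- \<sigma>)"
    define e where "e = (E n * real n powr (- 1 - \<sigma>)) powr (1 / \<delta>) / 2"
    have "0 \<le> 4 * D" "0 \<le> Z" using D Z by simp_all
    note bal = balanced_bound[OF \<delta>(1) \<beta> \<alpha>_def elim(2) elim(1) E_upper A0 this,
        folded \<sigma>_def, folded K_def e_def, folded s_def]
    have "expectation (\<lambda>x. ((\<Sum>i<n. X i x) - (\<Sum>i<n. expectation (X i)))\<^sup>2) = (\<Sum>i<n. \<Sum>j<n. c i j)"
      using second_moment_centered_sum[of X n, OF intX intXX] by (simp add: c_def EX)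
    also have "\<dots> \<le> E n + 2 * ((real i0 + K) * E n + 2 * (A * e powr \<delta>) * real n * E n
        + (A * e powr \<delta>)\<^sup>2 * (real n)\<^sup>2 + (4 * D * e powr (-2) * K powr (s - \<alpha>)) * Z * real n)"
      unfolding E_def
    proof (rule covariance_sum_le[where c=c and m=m and w="\<lambda>k. real k powr (- s)", OF c_sym m(1) c_triv])
      fix i j assume ij: "i0 \<le> i" "i < j" "K < real (j - i)"
      have "4 * D * e powr (-2) * real (j - i) powr (- \<alpha>)
          \<le> 4 * D * e powr (-2) * (K powr (s - \<alpha>) * real (j - i) powr (- s))"
        using D by (intro mult_left_mono powr_decay_split bal(2) ij s\<alpha>) auto
      then show "c i j \<le> (A * e powr \<delta>) * (m i + m j) + (A * e powr \<delta>)\<^sup>2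
          + 4 * D * e powr (-2) * K powr (s - \<alpha>) * real (j - i) powr (- s)"
        using far[OF ij(1,2) bal(3,4)] by (simp add: mult.assoc)
    qed (use A0 D Z bal(2) in auto)
    also have "\<dots> \<le> R * E n powr (2 - \<sigma>)"
      using bal(5)[of i0] by (simp add: R_def)
    finally show ?case by (simp add: EX E_def)
  qed
  then have "AE x in M. (\<lambda>n. (\<Sum>i<n. X i x) / (\<Sum>i<n. expectation (X i))) \<longlonglongrightarrow> 1"
  proof (rule strong_law_if_variance_bound[OF X_meas X01, rotated 2])
    show "filterlim (\<lambda>n. \<Sum>i<n. expectation (X i)) at_top sequentially"
      using E_lim by (simp add: EX E_def[abs_def])
    show "0 < \<sigma>"
      unfolding \<sigma>_def using \<beta> s1 s\<alpha> by simp
  qed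
  then show ?thesis by (simp add: EX X_def m_def B_def)
qed

end
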